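(* Let $X:\mathbb{R}^d\to\mathbb{R}$ be locally bounded, with large deviation spectrum $\mathcal{D}_{LD}$ based on wavelet leaders. Let $g$ be an admissible function, and for $(\gamma,\delta)\in\mathbb{R}^+\times\mathbb{R}$ let $g_{\gamma,\delta}(x)=g(\gamma(x-\delta))$ be its dilated and translated templates, with generalized Legendre spectra $\mathcal{L}_{g_{\gamma,\delta}}(h)=(\mathcal{D}_{LD}+g_{\gamma,\delta})^{\star\star}(h)-g_{\gamma,\delta}(h)$. Then for any dense countable set $\Upsilon\subset\mathbb{R}^+\times\mathbb{R}$, for all $(\gamma,\delta)\in\Upsilon$ and all $h\in\mathbb{R}$, $$\mathcal{L}_{g_{\gamma,\delta}}(h)\ \ge\ \mathcal{L}_{\Upsilon}(h):=\inf_{(\gamma',\delta')\in\Upsilon}\mathcal{L}_{g_{\gamma',\delta'}}(h)\ =\ \mathcal{D}_{LD}(h).$$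
   Context: Wavelets: let $\{\psi^{(i)}\}_{i=1,\dots,2^d-1}$ be mother wavelets (oscillating functions with fast decay and vanishing moments up to order $N_\psi$: $\int y^k\psi^{(i)}(y)\,dy=0$ for $k=0,\dots,N_\psi-1$) such that $\{2^{dj/2}\psi^{(i)}(2^jy-k): i=1,\dots,2^d-1,\ j\in\mathbb{Z},\ k\in\mathbb{Z}^d\}$ is an orthonormal basis of $L^2(\mathbb{R}^d)$. The wavelet coefficients of $X$ are $c^{(i)}_{j,k}=2^{dj/2}\int_{\mathbb{R}^d}X(y)\psi^{(i)}(2^jy-k)\,dy$. Wavelet leaders: let $\lambda_{j,k}=\prod_{m=1}^d[2^{-j}k_m,2^{-j}(k_m+1))$ be the dyadic cube of width $2^{-j}$ at position $2^{-j}k$, and let $3\lambda_{j,k}$ be the union of $\lambda_{j,k}$ and its $3^d-1$ closest neighbors of the same width. The wavelet leader of $\lambda_{j,k}$ is $$L_{j,k}=\sup_{i,\ \lambda_{j',k'}\subset 3\lambda_{j,k}}2^{dj'/2}|c^{(i)}_{j',k'}| .$$ At each scale $j$ a finite number $n_j$ of leaders is considered (those of the cubes in the analyzed bounded domain), with $n_j\sim 2^{dj}$. Large deviation spectrum: with $\log_2 0=-\infty$, for $h\in\mathbb{R}$ and $\epsilon>0$, let $$D(h,2^{-j},\epsilon)=\frac1j\log_2\,\mathrm{card}\Big\{k:\ h-\epsilon\le \frac{\log_2 L_{j,k}}{-j}\le h+\epsilon\Big\},$$ where $k$ ranges over the $n_j$ positions at scale $j$. Then $$\mathcal{D}_{LD}(h)=\lim_{\epsilon\to0}\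 \limsup_{j\to+\infty}D(h,2^{-j},\epsilon)\in\{-\infty\}\cup[0,d].$$ Legendre transform: for $f:\mathbb{R}\to\mathbb{R}\cup\{-\infty\}$, $f^\star(q)=\inf_{h}\{d+qh-f(h)\}$, and $f^{\star\star}=(f^\star)^\star$, i.e. $f^{\star\star}(h)=\inf_q\{d+qh-f^\star(q)\}$. Admissible function: a continuous function $g:\mathbb{R}\to\mathbb{R}\cup\{-\infty\}$ such that (i) $g(x)\to-\infty$ when $x\to\pm\infty$; (ii) $g(x)\ne-\infty$ on an (arbitrary) interval $I$ of nonempty interior; (iii) $g$ is continuous on $I$. Here $\mathbb{R}^+=(0,+\infty)$. The expression defining $\mathcal{L}_{g_{\gamma,\delta}}(h)$ is considered only where $g_{\gamma,\delta}(h)\neq-\infty$ (pairs $(\gamma,\delta)$ with $g_{\gamma,\delta}(h)=-\infty$ are disregarded at $h$, i.e. $\mathcal{L}_{g_{\gamma,\delta}}(h)=+\infty$ there). *)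

theory Defs
  imports "HOL-Analysis.Analysis" "HOL-Library.Landau_Symbols"
begin

text \<open>The ambient space \<open>\<real>\<^sup>d\<close> is \<open>real ^ 'n\<close> with \<open>d = CARD('n)\<close>; lattice positions are
  vectors of type \<open>int ^ 'n\<close>.\<close>

definition square_integrable :: "(real ^ 'n \<Rightarrow> real) \<Rightarrow> bool" where
  "square_integrable f \<longleftrightarrow>
     f \<in> borel_measurable lebesgue \<and> integrable lebesgue (\<lambda>y. (f y)\<^sup>2)"

text \<open>The last clause says that the finite linear combinations are dense for the \<open>L\<^sup>2\<close> norm.\<close>

definition L2_orthonormal_basis :: "'a set \<Rightarrow> ('a \<Rightarrow> real ^ 'n \<Rightarrow> real) \<Rightarrow> bool" where
  "L2_orthonormal_basis A e \<longleftrightarrow>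
     (\<forall>a\<in>A. square_integrable (e a)) \<and>
     (\<forall>a\<in>A. \<forall>b\<in>A. (LINT y|lebesgue. e a y * e b y) = (if a = b then 1 else 0)) \<and>
     (\<forall>f. square_integrable f \<longrightarrow> (\<forall>\<epsilon>>0. \<exists>F c. finite F \<and> F \<subseteq> A \<and>
        (LINT y|lebesgue. (f y - (\<Sum>a\<in>F. c a * e a y))\<^sup>2) < \<epsilon>))"

definition fast_decay :: "(real ^ 'n \<Rightarrow> real) \<Rightarrow> bool" where
  "fast_decay f \<longleftrightarrow> (\<forall>m::nat. \<exists>C. \<forall>y. \<bar>f y\<bar> \<le> C / (1 + norm y) ^ m)"

text \<open>The monomials \<open>y\<^sup>k\<close> range over all multi-indices \<open>k\<close> of total degree less than \<open>N\<close>.\<close>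

definition vanishing_moments :: "nat \<Rightarrow> (real ^ 'n \<Rightarrow> real) \<Rightarrow> bool" where
  "vanishing_moments N f \<longleftrightarrow>
     (\<forall>k :: 'n \<Rightarrow> nat. (\<Sum>m\<in>UNIV. k m) < N \<longrightarrow>
        (LINT y|lebesgue. (\<Prod>m\<in>UNIV. (y $ m) ^ k m) * f y) = 0)"

definition wavelet_indices :: "'n::finite itself \<Rightarrow> nat set" where
  "wavelet_indices _ = {1 .. 2 ^ CARD('n) - 1}"

definition dilate_translate ::
    "(real ^ 'n \<Rightarrow> real) \<Rightarrow> int \<Rightarrow> int ^ 'n \<Rightarrow> real ^ 'n \<Rightarrow> real" where
  "dilate_translate f j k y = f ((2 powi j) *\<^sub>R y - (\<chi> m. real_of_int (k $ m)))"

definition wavelet_scaling :: "'n::finite itself \<Rightarrow> int \<Rightarrow> real" where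
  "wavelet_scaling _ j = 2 powr (real CARD('n) * real_of_int j / 2)"

text \<open>Mother wavelets \<open>\<psi> i\<close>, \<open>1 \<le> i \<le> 2\<^sup>d - 1\<close>, with \<open>N\<close> vanishing moments. The requirement
  \<open>N \<ge> 1\<close>, i.e. a vanishing integral, is the meaning given to ``oscillating''.\<close>

definition mother_wavelets :: "nat \<Rightarrow> (nat \<Rightarrow> real ^ 'n \<Rightarrow> real) \<Rightarrow> bool" where
  "mother_wavelets N \<psi> \<longleftrightarrow>
     N \<ge> 1 \<and>
     (\<forall>i \<in> wavelet_indices TYPE('n). fast_decay (\<psi> i) \<and> vanishing_moments N (\<psi> i)) \<and>
     L2_orthonormal_basis
       (wavelet_indices TYPE('n) \<times> (UNIV :: int set) \<times> (UNIV :: (int ^ 'n) set))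
       (\<lambda>(i, j, k) y. wavelet_scaling TYPE('n) j * dilate_translate (\<psi> i) j k y)"

text \<open>If the integral does not converge, the value below is 0 by the convention for the Bochner
  integral. No integrability of \<open>X\<close> against the wavelets is imposed separately.\<close>

definition wavelet_coeff ::
    "(nat \<Rightarrow> real ^ 'n \<Rightarrow> real) \<Rightarrow> (real ^ 'n \<Rightarrow> real) \<Rightarrow> nat \<Rightarrow> int \<Rightarrow> int ^ 'n \<Rightarrow> real" where
  "wavelet_coeff \<psi> X i j k =
     wavelet_scaling TYPE('n) j * (LINT y|lebesgue. X y * dilate_translate (\<psi> i) j k y)"

definition dyadic_cube :: "int \<Rightarrow> int ^ 'n \<Rightarrow> (real ^ 'n) set" where
  "dyadic_cube j k =
     {y. \<forall>m. 2 powi (- j) * real_of_int (k $ m) \<le> y $ m \<and>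
             y $ m < 2 powi (- j) * (real_of_int (k $ m) + 1)}"

definition tripled_cube :: "int \<Rightarrow> int ^ 'n \<Rightarrow> (real ^ 'n) set" where
  "tripled_cube j k = (\<Union>k' \<in> {k'. \<forall>m. \<bar>k' $ m - k $ m\<bar> \<le> 1}. dyadic_cube j k')"

text \<open>The supremum is taken in the extended reals, so that it is meaningful even when infinite.\<close>

definition wavelet_leader ::
    "(nat \<Rightarrow> real ^ 'n \<Rightarrow> real) \<Rightarrow> (real ^ 'n \<Rightarrow> real) \<Rightarrow> int \<Rightarrow> int ^ 'n \<Rightarrow> ereal" where
  "wavelet_leader \<psi> X j k =
     (SUP (i, j', k') \<in> {(i, j', k'). i \<in> wavelet_indices TYPE('n) \<and>
                                       dyadic_cube j' k' \<subseteq> tripled_cube j k}.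
        ereal (wavelet_scaling TYPE('n) j' * \<bar>wavelet_coeff \<psi> X i j' k'\<bar>))"

text \<open>\<open>K j\<close> is the finite set of positions analyzed at scale \<open>j\<close>. The relation
  \<open>n\<^sub>j \<sim> 2\<^bsup>dj\<^esup>\<close> is read up to multiplicative constants, since the constant depends on the volume
  of the analyzed domain.\<close>

definition analyzed_positions :: "(nat \<Rightarrow> (int ^ 'n) set) \<Rightarrow> bool" where
  "analyzed_positions K \<longleftrightarrow>
     (\<forall>j. finite (K j)) \<and>
     (\<exists>\<Omega>. bounded \<Omega> \<and> (\<forall>j. \<forall>k \<in> K j. dyadic_cube (int j) k \<subseteq> \<Omega>)) \<and>
     (\<lambda>j. real (card (K j))) \<in> \<Theta>(\<lambda>j. 2 ^ (CARD('n) * j))"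

definition log2_ereal :: "ereal \<Rightarrow> ereal" where
  "log2_ereal x =
     (if x = \<infinity> then \<infinity> else if x \<le> 0 then - \<infinity> else ereal (log 2 (real_of_ereal x)))"

definition ld_count ::
    "(nat \<Rightarrow> real ^ 'n \<Rightarrow> real) \<Rightarrow> (real ^ 'n \<Rightarrow> real) \<Rightarrow> (nat \<Rightarrow> (int ^ 'n) set) \<Rightarrow>
     real \<Rightarrow> nat \<Rightarrow> real \<Rightarrow> ereal" where
  "ld_count \<psi> X K h j \<epsilon> =
     ereal (1 / real j) * log2_ereal (ereal (real (card
       {k \<in> K j. ereal (h - \<epsilon>) \<le> log2_ereal (wavelet_leader \<psi> X (int j) k) / ereal (- real j) \<and>
                 log2_ereal (wavelet_leader \<psi> X (int j) k) / ereal (- real j) \<le> ereal (h + \<epsilon>)})))"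

definition ld_spectrum ::
    "(nat \<Rightarrow> real ^ 'n \<Rightarrow> real) \<Rightarrow> (real ^ 'n \<Rightarrow> real) \<Rightarrow> (nat \<Rightarrow> (int ^ 'n) set) \<Rightarrow>
     real \<Rightarrow> ereal" where
  "ld_spectrum \<psi> X K h = Lim (at_right 0) (\<lambda>\<epsilon>. limsup (\<lambda>j. ld_count \<psi> X K h j \<epsilon>))"

definition legendre :: "nat \<Rightarrow> (real \<Rightarrow> ereal) \<Rightarrow> real \<Rightarrow> ereal" where
  "legendre d f q = (INF h. ereal (real d + q * h) - f h)"

definition admissible :: "(real \<Rightarrow> ereal) \<Rightarrow> bool" where
  "admissible g \<longleftrightarrow>
     continuous_on UNIV g \<and> (\<forall>x. g x \<noteq> \<infinity>) \<and>
     (g \<longlongrightarrow> - \<infinity>) at_top \<and> (g \<longlongrightarrow> - \<infinity>) at_bot \<and>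
     (\<exists>I. is_interval I \<and> interior I \<noteq> {} \<and> (\<forall>x\<in>I. g x \<noteq> - \<infinity>) \<and> continuous_on I g)"

definition template :: "(real \<Rightarrow> ereal) \<Rightarrow> real \<times> real \<Rightarrow> real \<Rightarrow> ereal" where
  "template g = (\<lambda>(\<gamma>, \<delta>) x. g (\<gamma> * (x - \<delta>)))"

text \<open>The generalized Legendre spectrum of \<open>D\<close> for the template \<open>g\<close>; the value \<open>\<infinity>\<close> disregards
  the points where \<open>g\<close> is \<open>- \<infinity>\<close>.\<close>

definition gen_legendre_spectrum ::
    "nat \<Rightarrow> (real \<Rightarrow> ereal) \<Rightarrow> (real \<Rightarrow> ereal) \<Rightarrow> real \<Rightarrow> ereal" where
  "gen_legendre_spectrum d D g h =
     (if g h = - \<infinity> then \<infinity> else legendre d (legendre d (\<lambda>x. D x + g x)) h - g h)"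

definition inf_legendre_spectrum ::
    "nat \<Rightarrow> (real \<Rightarrow> ereal) \<Rightarrow> (real \<Rightarrow> ereal) \<Rightarrow> (real \<times> real) set \<Rightarrow> real \<Rightarrow> ereal" where
  "inf_legendre_spectrum d D g \<Upsilon> h = (INF p\<in>\<Upsilon>. gen_legendre_spectrum d D (template g p) h)"

definition locally_bounded :: "('a::topological_space \<Rightarrow> 'b::metric_space) \<Rightarrow> bool" where
  "locally_bounded X \<longleftrightarrow> (\<forall>x. \<exists>U. open U \<and> x \<in> U \<and> bounded (X ` U))"

end

theory Submission
  imports Defs
begin

text \<open>The spectrum \<open>D\<close> is bounded above and upper semicontinuous. Let \<open>g\<close> attain its maximum \<open>M\<close>
  at \<open>x0\<close>. If \<open>\<gamma>\<close> is large and \<open>\<gamma> (h - \<delta>)\<close> is close to \<open>x0\<close>, then the template is close to \<open>M\<close> at \<open>h\<close>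
  and very negative away from \<open>h\<close>. So \<open>D\<close> plus the template is at most \<open>M + c\<close> everywhere, for any
  given \<open>c > D h\<close>. A biconjugate lies between the function and its supremum, which gives both
  inequalities.\<close>

section \<open>Biconjugates and generalized Legendre spectra\<close>

lemma legendre_legendre_ge:
  assumes "f h \<noteq> \<infinity>"
  shows "f h \<le> legendre d (legendre d f) h"
  unfolding legendre_def[of d "legendre d f"]
proof (rule INF_greatest)
  fix q
  \<comment> \<open>Evaluating the infimum at \<open>h\<close> gives a Fenchel-Young inequality,
    symmetric in \<open>f\<close> and its transform, so it can be solved for
    \<open>f h\<close>.\<close>
  have "legendre d f q \<le> ereal (real d + q * h) - f h"
    unfolding legendre_def by (rule INF_lower) simp
  with assms show "f h \<le> ereal (real d + h * q) - legendre d f q"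
    by (cases "f h"; cases "legendre d f q") (auto simp: mult.commute)
qed

lemma legendre_legendre_le:
  assumes "\<And>x. f x \<le> ereal m"
  shows "legendre d (legendre d f) h \<le> ereal m"
proof -
  \<comment> \<open>Slope 0 corresponds to the constant majorant \<open>m\<close>; the outer infimum
    is then also evaluated at slope 0.\<close>
  have "ereal (real d - m) \<le> legendre d f 0"
    unfolding legendre_def
  proof (rule INF_greatest)
    fix x
    show "ereal (real d - m) \<le> ereal (real d + 0 * x) - f x"
      using assms[of x] by (cases "f x") auto
  qed
  moreover have "legendre d (legendre d f) h \<le> ereal (real d + h * 0) - legendre d f 0"
    unfolding legendre_def[of d "legendre d f"] by (rule INF_lower) simp
  ultimately show ?thesis
    by (cases "legendre d f 0"; cases "legendre d (legendre d f) h") auto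
qed

lemma gen_legendre_spectrum_ge:
  assumes "D h \<noteq> \<infinity>" and "g h \<noteq> \<infinity>"
  shows "D h \<le> gen_legendre_spectrum d D g h"
proof (cases "g h = - \<infinity>")
  case True
  then show ?thesis by (simp add: gen_legendre_spectrum_def)
next
  case False
  have "D h + g h \<le> legendre d (legendre d (\<lambda>x. D x + g x)) h"
    using legendre_legendre_ge[of "\<lambda>x. D x + g x" h d] assms by simp
  then show ?thesis
    using False assms
    by (simp add: gen_legendre_spectrum_def ereal_le_minus_iff)
qed

text \<open>Applied with \<open>m\<close> close to \<open>D h\<close> plus the maximum of the
  template and \<open>u\<close> close to that maximum, so that \<open>m - u\<close> is close to
  \<open>D h\<close>.\<close>

lemma gen_legendre_spectrum_le:
  assumes "\<And>x. D x + g x \<le> ereal m" and "ereal u \<le> g h" and "g h \<noteq> \<infinity>"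
  shows "gen_legendre_spectrum d D g h \<le> ereal (m - u)"
  using legendre_legendre_le[of "\<lambda>x. D x + g x" m d h, OF assms(1)] assms(2,3)
  unfolding gen_legendre_spectrum_def
  by (cases "g h"; cases "legendre d (legendre d (\<lambda>x. D x + g x)) h") auto

section \<open>Maxima of admissible functions and choice of a template\<close>

lemma admissible_tails_less:
  assumes "admissible g" and "- \<infinity> < c"
  obtains a b where "\<And>x. x \<ge> a \<Longrightarrow> g x < c" and "\<And>x. x \<le> b \<Longrightarrow> g x < c"
proof -
  have "(g \<longlongrightarrow> - \<infinity>) at_top" "(g \<longlongrightarrow> - \<infinity>) at_bot"
    using assms(1) unfolding admissible_def by blast+
  then have "eventually (\<lambda>x. g x < c) at_top" "eventually (\<lambda>x. g x < c) at_bot"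
    using assms(2) by (blast intro: order_tendstoD(2))+
  then show thesis
    using that unfolding eventually_at_top_linorder eventually_at_bot_linorder by blast
qed

text \<open>Outside a compact interval \<open>g\<close> stays below some value \<open>g y\<close>
  other than \<open>- \<infinity>\<close>, so a maximum over that interval is global. It is finite
  because it is at least \<open>g y\<close> and \<open>g\<close> never takes the value
  \<open>\<infinity>\<close>.\<close>

lemma admissible_attains_max:
  assumes "admissible g"
  obtains x0 M where "g x0 = ereal M" and "\<And>x. g x \<le> ereal M"
proof -
  obtain I where "interior I \<noteq> {}" and "\<forall>x\<in>I. g x \<noteq> - \<infinity>"
    using assms unfolding admissible_def by blast
  then obtain y where y: "g y \<noteq> - \<infinity>"
    using interior_subset by blast
  then obtain a b where a: "\<And>x. x \<ge> a \<Longrightarrow> g x < g y" and b: "\<And>x. x \<le> b \<Longrightarrow> g x < g y"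
    using admissible_tails_less[OF assms, of "g y"] by auto
  have yab: "y \<in> {b..a}"
    using a[of y] b[of y] by force
  have "continuous_on {b..a} g"
    using assms unfolding admissible_def by (blast intro: continuous_on_subset)
  then obtain x0 where x0: "x0 \<in> {b..a}" "\<And>x. x \<in> {b..a} \<Longrightarrow> g x \<le> g x0"
    using continuous_attains_sup[of "{b..a}" g] yab by auto
  have max: "g x \<le> g x0" for x
  proof (cases "x \<in> {b..a}")
    case False
    then have "g x < g y" using a[of x] b[of x] by force
    also have "\<dots> \<le> g x0" using x0(2) yab by blast
    finally show ?thesis by simp
  qed (use x0 in blast)
  obtain M where "g x0 = ereal M"
    using max[of y] y assms unfolding admissible_def by (cases "g x0") auto
  then show thesis using max that by metis
qed

lemma dense_parameter_exists:
  assumes "{0<..} \<times> UNIV \<subseteq> closure \<Upsilon>" and "0 < \<eta>"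
  obtains \<gamma> \<delta> :: real where "(\<gamma>, \<delta>) \<in> \<Upsilon>" and "G < \<gamma>" and "0 < \<gamma>" and "\<bar>\<gamma> * (h - \<delta>) - x0\<bar> < \<eta>"
proof -
  define U where "U = {p :: real \<times> real. max G 0 < fst p \<and> \<bar>fst p * (h - snd p) - x0\<bar> < \<eta>}"
  \<comment> \<open>The pair \<open>(s, h - x0 / s)\<close> sends \<open>h\<close> exactly to
    \<open>x0\<close>; strict inequalities make \<open>U\<close> open, so density provides a nearby
    pair in \<open>\<Upsilon>\<close>.\<close>
  define s where "s = max G 0 + 1"
  have "open U"
    unfolding U_def by (intro open_Collect_conj open_Collect_less continuous_intros)
  moreover have "(s, h - x0 / s) \<in> U" "(s, h - x0 / s) \<in> closure \<Upsilon>"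
    using assms unfolding U_def s_def by auto
  ultimately have "U \<inter> \<Upsilon> \<noteq> {}"
    using open_Int_closure_eq_empty by blast
  then obtain \<gamma> \<delta> where "(\<gamma>, \<delta>) \<in> \<Upsilon>" and "(\<gamma>, \<delta>) \<in> U"
    by auto
  then show thesis using that unfolding U_def by auto
qed

section \<open>Recovering a bounded upper semicontinuous function from its templates\<close>

lemma inf_legendre_spectrum_eq:
  assumes usc: "\<And>c. D h < ereal c \<Longrightarrow> eventually (\<lambda>x. D x < ereal c) (nhds h)"
    and bdd: "\<And>x. D x \<le> ereal B"
    and g: "admissible g"
    and dense: "{0<..} \<times> UNIV \<subseteq> closure \<Upsilon>"
  shows "inf_legendre_spectrum d D g \<Upsilon> h = D h"
proof (rule antisym)
  have g_fin: "g x \<noteq> \<infinity>" for x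
    using g unfolding admissible_def by blast
  show "D h \<le> inf_legendre_spectrum d D g \<Upsilon> h"
    unfolding inf_legendre_spectrum_def
  proof (rule INF_greatest)
    fix p
    show "D h \<le> gen_legendre_spectrum d D (template g p) h"
      by (rule gen_legendre_spectrum_ge)
        (use bdd[of h] g_fin in \<open>auto simp: template_def split: prod.split\<close>)
  qed
  show "inf_legendre_spectrum d D g \<Upsilon> h \<le> D h"
  \<comment> \<open>Comparing with every real \<open>c\<close> above \<open>D h\<close> also handles
    \<open>D h = - \<infinity>\<close>.\<close>
  proof (rule ereal_le_real)
    fix c assume "D h \<le> ereal c"
    show "inf_legendre_spectrum d D g \<Upsilon> h \<le> ereal c"
    proof (rule ereal_le_epsilon2)
      fix e :: real assume "0 < e"
      obtain x0 M where M: "g x0 = ereal M" "\<And>x. g x \<le> ereal M"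
        using admissible_attains_max[OF g] by blast
      \<comment> \<open>The error \<open>e\<close> is split in two: one half puts \<open>c'\<close>
        strictly above \<open>D h\<close>, the other is the loss of \<open>g\<close> below
        \<open>M\<close> near \<open>x0\<close>. The final bound is
        \<open>M + c' - (M - e / 2) = c + e\<close>.\<close>
      define c' where "c' = c + e / 2"
      have "D h < ereal c'"
        using \<open>D h \<le> ereal c\<close> \<open>0 < e\<close> unfolding c'_def by (cases "D h") auto
      then obtain \<rho> where \<rho>: "0 < \<rho>" "\<And>x. \<bar>x - h\<bar> < \<rho> \<Longrightarrow> D x < ereal c'"
        using usc unfolding eventually_nhds_metric dist_real_def by blast
      have "isCont g x0"
        using g unfolding admissible_def by (simp add: continuous_on_eq_continuous_at)
      then have "(g \<longlongrightarrow> g x0) (nhds x0)"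
        by (simp add: isCont_def tendsto_at_iff_tendsto_nhds)
      then have "eventually (\<lambda>x. ereal (M - e / 2) < g x) (nhds x0)"
        by (rule order_tendstoD(1)) (use \<open>0 < e\<close> M(1) in simp)
      then obtain \<eta> where \<eta>: "0 < \<eta>" "\<And>x. \<bar>x - x0\<bar> < \<eta> \<Longrightarrow> ereal (M - e / 2) < g x"
        unfolding eventually_nhds_metric dist_real_def by blast
      \<comment> \<open>At this level the tails of \<open>g\<close> added to the global bound
        \<open>B\<close> give exactly \<open>M + c'\<close>.\<close>
      obtain a b where a: "\<And>x. x \<ge> a \<Longrightarrow> g x < ereal (M + c' - B)"
        and b: "\<And>x. x \<le> b \<Longrightarrow> g x < ereal (M + c' - B)"
        using admissible_tails_less[OF g, of "ereal (M + c' - B)"] by auto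
      \<comment> \<open>A point farther than \<open>A\<close> from
        \<open>\<gamma> * (h - \<delta>)\<close>, itself within \<open>\<eta>\<close> of
        \<open>x0\<close>, lies beyond \<open>a\<close> or \<open>b\<close>. With
        \<open>\<gamma> > A / \<rho>\<close>, every \<open>x\<close> at distance at least
        \<open>\<rho>\<close> from \<open>h\<close> is sent that far.\<close>
      define A where "A = max \<bar>a\<bar> \<bar>b\<bar> + \<bar>x0\<bar> + \<eta>"
      obtain \<gamma> \<delta> where p: "(\<gamma>, \<delta>) \<in> \<Upsilon>" "A / \<rho> < \<gamma>" "0 < \<gamma>" "\<bar>\<gamma> * (h - \<delta>) - x0\<bar> < \<eta>"
        using dense_parameter_exists[OF dense \<eta>(1)] by metis
      have "D x + template g (\<gamma>, \<delta>) x \<le> ereal (M + c')" for x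
      proof (cases "\<bar>x - h\<bar> < \<rho>")
        case True
        then have "D x + g (\<gamma> * (x - \<delta>)) \<le> ereal c' + ereal M"
          using \<rho>(2) M(2) by (intro add_mono) (auto intro: less_imp_le)
        then show ?thesis by (simp add: template_def add.commute)
      next
        case False
        have "A < \<gamma> * \<rho>"
          using p(2) \<rho>(1) by (simp add: field_simps)
        also have "\<dots> \<le> \<gamma> * \<bar>x - h\<bar>"
          using False p(3) by simp
        also have "\<dots> = \<bar>\<gamma> * (x - \<delta>) - \<gamma> * (h - \<delta>)\<bar>"
          using p(3) by (simp add: abs_mult flip: right_diff_distrib)
        finally have "\<gamma> * (x - \<delta>) \<ge> a \<or> \<gamma> * (x - \<delta>) \<le> b"
          using p(4) unfolding A_def by arith
        then have "g (\<gamma> * (x - \<delta>)) \<le> ereal (M + c' - B)"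
          using a b less_imp_le by blast
        then have "D x + g (\<gamma> * (x - \<delta>)) \<le> ereal B + ereal (M + c' - B)"
          using bdd by (intro add_mono)
        then show ?thesis by (simp add: template_def)
      qed
      moreover have "ereal (M - e / 2) \<le> template g (\<gamma>, \<delta>) h"
        using \<eta>(2)[OF p(4)] by (simp add: template_def)
      ultimately have "gen_legendre_spectrum d D (template g (\<gamma>, \<delta>)) h
          \<le> ereal (M + c' - (M - e / 2))"
        using g_fin by (intro gen_legendre_spectrum_le) (auto simp: template_def)
      moreover have "inf_legendre_spectrum d D g \<Upsilon> h
          \<le> gen_legendre_spectrum d D (template g (\<gamma>, \<delta>)) h"
        unfolding inf_legendre_spectrum_def using p(1) by (rule INF_lower)
      ultimately show "inf_legendre_spectrum d D g \<Upsilon> h \<le> ereal c + ereal e"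
        by (simp add: c'_def)
    qed
  qed
qed

section \<open>Regularity of the large deviation spectrum\<close>

lemma log2_ereal_mono: "x \<le> y \<Longrightarrow> log2_ereal x \<le> log2_ereal y"
  unfolding log2_ereal_def by (cases x; cases y) auto

lemma ld_count_mono:
  fixes K :: "nat \<Rightarrow> (int ^ 'n) set"
  assumes "finite (K j)" and "h' - \<epsilon>' \<le> h - \<epsilon>" and "h + \<epsilon> \<le> h' + \<epsilon>'"
  shows "ld_count \<psi> X K h j \<epsilon> \<le> ld_count \<psi> X K h' j \<epsilon>'"
proof -
  have "ereal (h' - \<epsilon>') \<le> ereal (h - \<epsilon>)" "ereal (h + \<epsilon>) \<le> ereal (h' + \<epsilon>')"
    using assms(2,3) by simp_all
  note window = order_trans[OF this(1)] order_trans[OF _ this(2)]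
  have "card {k \<in> K j. ereal (h - \<epsilon>) \<le> e k \<and> e k \<le> ereal (h + \<epsilon>)}
      \<le> card {k \<in> K j. ereal (h' - \<epsilon>') \<le> e k \<and> e k \<le> ereal (h' + \<epsilon>')}" for e :: "int ^ 'n \<Rightarrow> ereal"
    using assms(1) by (intro card_mono) (auto intro: window)
  then show ?thesis
    unfolding ld_count_def
    by (intro ereal_mult_left_mono log2_ereal_mono) simp_all
qed

text \<open>The limsup is nondecreasing in \<open>\<epsilon>\<close>, so its limit at 0 from the
  right exists and is the infimum. In this form any single \<open>\<epsilon> > 0\<close> yields an
  upper bound.\<close>

lemma ld_spectrum_eq_INF:
  fixes K :: "nat \<Rightarrow> (int ^ 'n) set"
  assumes "\<And>j. finite (K j)"
  shows "ld_spectrum \<psi> X K h = (INF \<epsilon>\<in>{0<..}. limsup (\<lambda>j. ld_count \<psi> X K h j \<epsilon>))"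
proof -
  define L where "L \<epsilon> = limsup (\<lambda>j. ld_count \<psi> X K h j \<epsilon>)" for \<epsilon>
  have mono: "L \<epsilon> \<le> L \<epsilon>'" if "\<epsilon> \<le> \<epsilon>'" for \<epsilon> \<epsilon>'
    unfolding L_def using that assms
    by (intro Limsup_mono always_eventually allI ld_count_mono) auto
  have "(L \<longlongrightarrow> (INF \<epsilon>\<in>{0<..}. L \<epsilon>)) (at_right 0)"
  proof (rule order_tendstoI)
    fix a assume "a < (INF \<epsilon>\<in>{0<..}. L \<epsilon>)"
    then have "a < L \<epsilon>" if "0 < \<epsilon>" for \<epsilon>
      using that by (auto dest: less_INF_D)
    then show "eventually (\<lambda>\<epsilon>. a < L \<epsilon>) (at_right 0)"
      by (auto simp: eventually_at_right_field intro: exI[of _ 1])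
  next
    fix a assume "(INF \<epsilon>\<in>{0<..}. L \<epsilon>) < a"
    then obtain \<epsilon> where "0 < \<epsilon>" and "L \<epsilon> < a"
      by (auto simp: INF_less_iff)
    then have "L x < a" if "x < \<epsilon>" for x
      using that mono[of x \<epsilon>] by simp
    then show "eventually (\<lambda>\<epsilon>. L \<epsilon> < a) (at_right 0)"
      using \<open>0 < \<epsilon>\<close> by (auto simp: eventually_at_right_field intro!: exI[of _ \<epsilon>])
  qed
  then have "Lim (at_right 0) L = (INF \<epsilon>\<in>{0<..}. L \<epsilon>)"
    by (rule tendsto_Lim[rotated]) simp
  then show ?thesis
    unfolding ld_spectrum_def L_def .
qed

text \<open>If \<open>x\<close> is within \<open>\<epsilon> / 2\<close> of \<open>h\<close>, the
  window of radius \<open>\<epsilon> / 2\<close> around \<open>x\<close> lies inside the window of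
  radius \<open>\<epsilon>\<close> around \<open>h\<close>.\<close>

lemma ld_spectrum_upper_semicontinuous:
  fixes K :: "nat \<Rightarrow> (int ^ 'n) set"
  assumes "\<And>j. finite (K j)" and "ld_spectrum \<psi> X K h < c"
  shows "eventually (\<lambda>x. ld_spectrum \<psi> X K x < c) (nhds h)"
proof -
  obtain \<epsilon> where \<epsilon>: "0 < \<epsilon>" "limsup (\<lambda>j. ld_count \<psi> X K h j \<epsilon>) < c"
    using assms(2) unfolding ld_spectrum_eq_INF[of K, OF assms(1)] by (auto simp: INF_less_iff)
  have "ld_spectrum \<psi> X K x < c" if x: "dist x h < \<epsilon> / 2" for x
  proof -
    have "ld_spectrum \<psi> X K x \<le> limsup (\<lambda>j. ld_count \<psi> X K x j (\<epsilon> / 2))"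
      unfolding ld_spectrum_eq_INF[of K, OF assms(1)] using \<epsilon>(1) by (intro INF_lower) auto
    also have "\<dots> \<le> limsup (\<lambda>j. ld_count \<psi> X K h j \<epsilon>)"
      using x unfolding dist_real_def
      by (intro Limsup_mono always_eventually allI ld_count_mono assms(1))
        (auto simp: abs_if split: if_splits)
    finally show ?thesis using \<epsilon>(2) by simp
  qed
  then show ?thesis
    unfolding eventually_nhds_metric using \<epsilon>(1) half_gt_zero by blast
qed

lemma ld_spectrum_bounded_above:
  fixes K :: "nat \<Rightarrow> (int ^ 'n) set"
  assumes "analyzed_positions K"
  obtains B where "\<And>h. ld_spectrum \<psi> X K h \<le> ereal B"
proof -
  have fin: "finite (K j)" for j
    using assms unfolding analyzed_positions_def by blast
  have "(\<lambda>j. real (card (K j))) \<in> O(\<lambda>j. 2 ^ (CARD('n) * j))"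
    using assms unfolding analyzed_positions_def by blast
  then obtain C where C: "eventually (\<lambda>j. real (card (K j)) \<le> C * 2 ^ (CARD('n) * j)) sequentially"
    unfolding bigo_def by auto
  \<comment> \<open>From \<open>log 2 (C * 2 ^ (d * j)) / j = log 2 C / j + d\<close> with
    \<open>d = CARD('n)\<close>. Replacing \<open>C\<close> by \<open>max C 1\<close> makes the
    logarithm nonnegative, so dividing it by \<open>j \<ge> 1\<close> does not increase it.\<close>
  define B where "B = log 2 (max C 1) + real CARD('n)"
  have "ld_spectrum \<psi> X K h \<le> ereal B" for h
  proof -
    have "ld_spectrum \<psi> X K h \<le> limsup (\<lambda>j. ld_count \<psi> X K h j 1)"
      unfolding ld_spectrum_eq_INF[of K, OF fin] by (intro INF_lower) auto
    also have "\<dots> \<le> ereal B"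
    proof (rule Limsup_bounded)
      show "eventually (\<lambda>j. ld_count \<psi> X K h j 1 \<le> ereal B) sequentially"
        using C eventually_gt_at_top[of 0]
      proof eventually_elim
        case (elim j)
        \<comment> \<open>The set \<open>S\<close> may be empty, with logarithm
          \<open>- \<infinity>\<close>; monotonicity of \<open>log2_ereal\<close> covers this case
          too.\<close>
        have count_le: "ereal (1 / real j) * log2_ereal (ereal (real (card S))) \<le> ereal B"
          if "S \<subseteq> K j" for S
        proof -
          define t where "t = log 2 (max C 1) + real CARD('n) * real j"
          have "real (card S) \<le> C * 2 ^ (CARD('n) * j)"
            using elim(1) card_mono[OF fin that] by linarith
          also have "\<dots> \<le> max C 1 * 2 ^ (CARD('n) * j)"
            by (intro mult_right_mono) auto
          finally have "log2_ereal (ereal (real (card S)))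
              \<le> log2_ereal (ereal (max C 1 * 2 ^ (CARD('n) * j)))"
            by (intro log2_ereal_mono) simp
          also have "\<dots> = ereal t"
            by (auto simp: log2_ereal_def t_def log_mult log_nat_power not_le)
          finally have "ereal (1 / real j) * log2_ereal (ereal (real (card S)))
              \<le> ereal (1 / real j) * ereal t"
            by (intro ereal_mult_left_mono) auto
          also have "ereal (1 / real j) * ereal t = ereal (log 2 (max C 1) / real j + real CARD('n))"
            using elim(2) by (simp add: t_def field_simps)
          also have "\<dots> \<le> ereal B"
          proof -
            have "log 2 (max C 1) / real j \<le> log 2 (max C 1) / 1"
              using elim(2) by (intro divide_left_mono) auto
            then show ?thesis by (simp add: B_def)
          qed
          finally show ?thesis .
        qed
        show ?case
          unfolding ld_count_def by (rule count_le) auto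
      qed
    qed
    finally show ?thesis .
  qed
  then show thesis using that by blast
qed

theorem theorem1:
  fixes N :: nat
    and \<psi> :: "nat \<Rightarrow> real ^ 'n \<Rightarrow> real"
    and X :: "real ^ 'n \<Rightarrow> real"
    and K :: "nat \<Rightarrow> (int ^ 'n) set"
    and g :: "real \<Rightarrow> ereal"
    and \<Upsilon> :: "(real \<times> real) set"
  assumes "mother_wavelets N \<psi>"
    and "locally_bounded X"
    and "analyzed_positions K"
    and "admissible g"
    and "\<Upsilon> \<subseteq> {0<..} \<times> UNIV"
    and "countable \<Upsilon>"
    and "{0<..} \<times> UNIV \<subseteq> closure \<Upsilon>"
  shows "\<forall>p\<in>\<Upsilon>. \<forall>h.
    gen_legendre_spectrum CARD('n) (ld_spectrum \<psi> X K) (template g p) h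
      \<ge> inf_legendre_spectrum CARD('n) (ld_spectrum \<psi> X K) g \<Upsilon> h \<and>
    inf_legendre_spectrum CARD('n) (ld_spectrum \<psi> X K) g \<Upsilon> h = ld_spectrum \<psi> X K h"
proof (intro ballI allI conjI)
  fix p h assume "p \<in> \<Upsilon>"
  then show "inf_legendre_spectrum CARD('n) (ld_spectrum \<psi> X K) g \<Upsilon> h
      \<le> gen_legendre_spectrum CARD('n) (ld_spectrum \<psi> X K) (template g p) h"
    unfolding inf_legendre_spectrum_def by (rule INF_lower)
next
  fix h
  \<comment> \<open>It remains to supply the two properties required of \<open>D\<close>: the upper
    bound comes from the growth of \<open>card (K j)\<close>, semicontinuity from the finiteness of
    each \<open>K j\<close>.\<close>
  obtain B where "\<And>x. ld_spectrum \<psi> X K x \<le> ereal B"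
    using ld_spectrum_bounded_above[OF assms(3)] by blast
  moreover have "\<And>j. finite (K j)"
    using assms(3) unfolding analyzed_positions_def by blast
  ultimately show "inf_legendre_spectrum CARD('n) (ld_spectrum \<psi> X K) g \<Upsilon> h = ld_spectrum \<psi> X K h"
    using assms(4,7) by (intro inf_legendre_spectrum_eq ld_spectrum_upper_semicontinuous)
qed

end
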